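(* Let $\mathcal{K}$ be one of the classes $Nil$, $Sol$, $Alt$, $Sym$, $Fin$. An existentially closed group is $\mathcal{K}$-approximable if and only if all groups are $\mathcal{K}$-approximable. (That is, for every existentially closed group $E$: $E$ is $\mathcal{K}$-approximable if and only if every group is $\mathcal{K}$-approximable.)
   Context: $Nil$, $Sol$, $Fin$, $Alt$, $Sym$ are the classes of finite nilpotent, finite solvable, all finite, finite alternating, and finite symmetric groups, respectively. A group $E$ is existentially closed if every finite set of equations and inequations with coefficients in $E$ that has a solution in some group containing $E$ has a solution in $E$. For a group $H$, $X\subseteq H$ and $n\in\mathbb{N}$, put $C_n(X,H)=\{x_1^{g_1}\cdots x_n^{g_n} : x_i\in X\text{ or }x_i^{-1}\in X,\ g_i\in H\}$, where $x^g=g^{-1}xg$. A set $Y\subseteq H$ is $n$-separated from $X$ in $H$ if $Y\cap C_n(X,H)=\emptyset$. A group $G$ is $\mathcal{K}$-approximable if for every finite $\Phi\subset G$ and every $n\in\mathbb{N}$ there exist $H\in\mathcal{K}$ and a map $\phi:\Phi\to H$ such that $\phi(1)=1$ (when $1\in\Phi$) and $\phi(\Phi\setminus\{1\})$ is $n$-separated in $H$ from $\{\phi(g)\phi(h)(\phi(gh))^{-1} : g,h,gh\in\Phi\}$. *)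

theory Defs
  imports "HOL-Algebra.Sym_Groups"
begin

section \<open>The classes of finite groups\<close>

primrec lower_central :: "('a, 'm) monoid_scheme \<Rightarrow> nat \<Rightarrow> 'a set" where
  "lower_central G 0 = carrier G"
| "lower_central G (Suc k) = generate G
     {x \<otimes>\<^bsub>G\<^esub> y \<otimes>\<^bsub>G\<^esub> inv\<^bsub>G\<^esub> x \<otimes>\<^bsub>G\<^esub> inv\<^bsub>G\<^esub> y | x y. x \<in> lower_central G k \<and> y \<in> carrier G}"

definition nilpotent :: "('a, 'm) monoid_scheme \<Rightarrow> bool" where
  "nilpotent G \<longleftrightarrow> (\<exists>k. lower_central G k = {\<one>\<^bsub>G\<^esub>})"

text \<open>Every finite group is isomorphic to one whose elements are natural numbers, so each class
  is represented, up to isomorphism, by its members of type \<^typ>\<open>nat monoid\<close>.\<close>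

definition Nil_groups :: "nat monoid set" where
  "Nil_groups = {G. group G \<and> finite (carrier G) \<and> nilpotent G}"

definition Sol_groups :: "nat monoid set" where
  "Sol_groups = {G. group G \<and> finite (carrier G) \<and> solvable G}"

definition Fin_groups :: "nat monoid set" where
  "Fin_groups = {G. group G \<and> finite (carrier G)}"

definition Alt_groups :: "nat monoid set" where
  "Alt_groups = {G. group G \<and> (\<exists>n. G \<cong> alt_group n)}"

definition Sym_groups :: "nat monoid set" where
  "Sym_groups = {G. group G \<and> (\<exists>n. G \<cong> sym_group n)}"


section \<open>Approximability\<close>

definition conj_products :: "nat \<Rightarrow> 'h set \<Rightarrow> ('h, 'm) monoid_scheme \<Rightarrow> 'h set" where
  "conj_products n X H =
     {foldr (\<otimes>\<^bsub>H\<^esub>) (map (\<lambda>i. inv\<^bsub>H\<^esub> (g i) \<otimes>\<^bsub>H\<^esub> x i \<otimes>\<^bsub>H\<^esub> g i) [0..<n]) \<one>\<^bsub>H\<^esub> | x g.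
        \<forall>i<n. x i \<in> carrier H \<and> (x i \<in> X \<or> inv\<^bsub>H\<^esub> (x i) \<in> X) \<and> g i \<in> carrier H}"

definition separated :: "nat \<Rightarrow> 'h set \<Rightarrow> 'h set \<Rightarrow> ('h, 'm) monoid_scheme \<Rightarrow> bool" where
  "separated n Y X H \<longleftrightarrow> Y \<inter> conj_products n X H = {}"

definition defects ::
  "('g, 'm) monoid_scheme \<Rightarrow> ('h, 'k) monoid_scheme \<Rightarrow> 'g set \<Rightarrow> ('g \<Rightarrow> 'h) \<Rightarrow> 'h set" where
  "defects G H \<Phi> \<phi> =
     {\<phi> g \<otimes>\<^bsub>H\<^esub> \<phi> h \<otimes>\<^bsub>H\<^esub> inv\<^bsub>H\<^esub> (\<phi> (g \<otimes>\<^bsub>G\<^esub> h)) | g h. g \<in> \<Phi> \<and> h \<in> \<Phi> \<and> g \<otimes>\<^bsub>G\<^esub> h \<in> \<Phi>}"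

definition approximable :: "nat monoid set \<Rightarrow> ('g, 'm) monoid_scheme \<Rightarrow> bool" where
  "approximable K G \<longleftrightarrow>
     (\<forall>\<Phi> n. finite \<Phi> \<and> \<Phi> \<subseteq> carrier G \<longrightarrow>
        (\<exists>H \<in> K. \<exists>\<phi> \<in> \<Phi> \<rightarrow> carrier H.
           (\<one>\<^bsub>G\<^esub> \<in> \<Phi> \<longrightarrow> \<phi> \<one>\<^bsub>G\<^esub> = \<one>\<^bsub>H\<^esub>) \<and>
           separated n (\<phi> ` (\<Phi> - {\<one>\<^bsub>G\<^esub>})) (defects G H \<Phi> \<phi>) H))"


section \<open>Existentially closed groups\<close>

datatype (gterm_coeffs: 'a) gterm =
  Var nat | Coeff 'a | One | Mult "'a gterm" "'a gterm" | Inv "'a gterm"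

datatype (gconstraint_coeffs: 'a) gconstraint =
  Equation "'a gterm" "'a gterm" | Inequation "'a gterm" "'a gterm"

text \<open>The map \<open>h\<close> interprets the coefficients in \<open>H\<close>, and \<open>a\<close> assigns values to the variables.\<close>

primrec gterm_val ::
  "('h, 'm) monoid_scheme \<Rightarrow> ('a \<Rightarrow> 'h) \<Rightarrow> (nat \<Rightarrow> 'h) \<Rightarrow> 'a gterm \<Rightarrow> 'h" where
  "gterm_val H h a (Var i) = a i"
| "gterm_val H h a (Coeff c) = h c"
| "gterm_val H h a One = \<one>\<^bsub>H\<^esub>"
| "gterm_val H h a (Mult s t) = gterm_val H h a s \<otimes>\<^bsub>H\<^esub> gterm_val H h a t"
| "gterm_val H h a (Inv t) = inv\<^bsub>H\<^esub> (gterm_val H h a t)"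

primrec satisfies ::
  "('h, 'm) monoid_scheme \<Rightarrow> ('a \<Rightarrow> 'h) \<Rightarrow> (nat \<Rightarrow> 'h) \<Rightarrow> 'a gconstraint \<Rightarrow> bool" where
  "satisfies H h a (Equation s t) \<longleftrightarrow> gterm_val H h a s = gterm_val H h a t"
| "satisfies H h a (Inequation s t) \<longleftrightarrow> gterm_val H h a s \<noteq> gterm_val H h a t"

definition has_solution ::
  "('h, 'm) monoid_scheme \<Rightarrow> ('a \<Rightarrow> 'h) \<Rightarrow> 'a gconstraint set \<Rightarrow> bool" where
  "has_solution H h S \<longleftrightarrow> (\<exists>a. range a \<subseteq> carrier H \<and> (\<forall>c \<in> S. satisfies H h a c))"

text \<open>A group containing \<open>E\<close> is a group \<open>H\<close> with a monomorphism from \<open>E\<close> to \<open>H\<close>. A definition cannot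
  quantify over the type of \<open>H\<close>; the type \<^typ>\<open>'a gterm monoid\<close> is large enough, because the
  subgroup generated by \<open>E\<close> and a solution consists of values of terms. The lemma
  \<open>existentially_closed_has_solution\<close> shows that the definition implies the property for groups \<open>H\<close>
  of every type.\<close>

definition existentially_closed :: "'a monoid \<Rightarrow> bool" where
  "existentially_closed E \<longleftrightarrow> group E \<and>
     (\<forall>S. finite S \<and> (\<forall>c \<in> S. gconstraint_coeffs c \<subseteq> carrier E) \<longrightarrow>
        (\<exists>(H :: 'a gterm monoid) h. group H \<and> h \<in> mon E H \<and> has_solution H h S) \<longrightarrow>
        has_solution E id S)"

lemma existentially_closed_has_solution:
  fixes E :: "'a monoid" and H :: "('c, 'm) monoid_scheme"
  assumes E: "existentially_closed E"
    and S: "finite S" "\<forall>c \<in> S. gconstraint_coeffs c \<subseteq> carrier E"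
    and H: "group H" and h: "h \<in> mon E H" and sol: "has_solution H h S"
  shows "has_solution E id S"
proof -
  interpret H: group H by fact
  have hc: "h x \<in> carrier H" if "x \<in> carrier E" for x
    using h that by (auto simp: mon_def hom_def)
  have hm: "h (x \<otimes>\<^bsub>E\<^esub> y) = h x \<otimes>\<^bsub>H\<^esub> h y" if "x \<in> carrier E" "y \<in> carrier E" for x y
    using h that by (auto simp: mon_def hom_def)
  have hi: "inj_on h (carrier E)" using h by (simp add: mon_def)
  obtain a where a: "range a \<subseteq> carrier H" "\<forall>c \<in> S. satisfies H h a c"
    using sol by (auto simp: has_solution_def)
  define T where "T = {t. gterm_coeffs t \<subseteq> carrier E}"
  define v where "v = gterm_val H h a"
  define U where "U = v ` T"
  have vc: "v t \<in> carrier H" if "t \<in> T" for t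
    using that unfolding T_def v_def
    by (induction t) (use a(1) hc in auto)
  have vU: "v t \<in> U" if "t \<in> T" for t using that by (simp add: U_def)
  have U1: "\<one>\<^bsub>H\<^esub> \<in> U" using vU[of One] by (simp add: T_def v_def)
  have Um: "x \<otimes>\<^bsub>H\<^esub> y \<in> U" if "x \<in> U" "y \<in> U" for x y
  proof -
    obtain s t where "s \<in> T" "t \<in> T" "x = v s" "y = v t" using \<open>x \<in> U\<close> \<open>y \<in> U\<close> by (auto simp: U_def)
    then show ?thesis using vU[of "Mult s t"] by (simp add: T_def v_def)
  qed
  have Ui: "inv\<^bsub>H\<^esub> x \<in> U" if "x \<in> U" for x
  proof -
    obtain t where "t \<in> T" "x = v t" using \<open>x \<in> U\<close> by (auto simp: U_def)
    then show ?thesis using vU[of "Inv t"] by (simp add: T_def v_def)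
  qed
  have Uc: "x \<in> carrier H" if "x \<in> U" for x using that vc by (auto simp: U_def)
  have Ua: "a i \<in> U" for i using vU[of "Var i"] by (simp add: T_def v_def)
  have Uh: "h x \<in> U" if "x \<in> carrier E" for x
    using vU[of "Coeff x"] that by (simp add: T_def v_def)
  define r where "r = inv_into T v"
  have vr: "v (r x) = x" if "x \<in> U" for x
    using that unfolding U_def r_def by (rule f_inv_into_f)
  define H' where "H' = \<lparr>carrier = r ` U, mult = (\<lambda>s t. r (v s \<otimes>\<^bsub>H\<^esub> v t)), one = r \<one>\<^bsub>H\<^esub>\<rparr>"
  have H'c: "carrier H' = r ` U" and H'1: "\<one>\<^bsub>H'\<^esub> = r \<one>\<^bsub>H\<^esub>"
    and H'm: "\<And>x y. x \<in> U \<Longrightarrow> y \<in> U \<Longrightarrow> r x \<otimes>\<^bsub>H'\<^esub> r y = r (x \<otimes>\<^bsub>H\<^esub> y)"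
    by (auto simp: H'_def vr)
  have gH': "group H'"
  proof (rule groupI)
    fix x assume "x \<in> carrier H'"
    then obtain u where u: "u \<in> U" "x = r u" by (auto simp: H'c)
    then have "r (inv\<^bsub>H\<^esub> u) \<otimes>\<^bsub>H'\<^esub> x = \<one>\<^bsub>H'\<^esub>" by (simp add: H'm H'1 Ui Uc)
    then show "\<exists>y \<in> carrier H'. y \<otimes>\<^bsub>H'\<^esub> x = \<one>\<^bsub>H'\<^esub>" using u Ui by (auto simp: H'c)
  qed (auto simp: H'c H'm H'1 U1 Um Uc H.m_assoc)
  then interpret H': group H' .
  have H'i: "inv\<^bsub>H'\<^esub> r x = r (inv\<^bsub>H\<^esub> x)" if "x \<in> U" for x
    by (rule H'.inv_equality) (use that in \<open>auto simp: H'm H'1 H'c Ui Uc\<close>)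
  have val: "gterm_val H' (r \<circ> h) (r \<circ> a) t = r (v t)" if "t \<in> T" for t
    using that
  proof (induction t)
    case (Mult s t)
    then have "s \<in> T" "t \<in> T" by (auto simp: T_def)
    with Mult.IH show ?case by (simp add: H'm vU) (simp add: v_def)
  next
    case (Inv t)
    then have "t \<in> T" by (auto simp: T_def)
    with Inv.IH show ?case by (simp add: H'i vU) (simp add: v_def)
  qed (simp_all add: v_def H'1)
  have mon': "r \<circ> h \<in> mon E H'"
  proof -
    have "inj_on r U" using vr by (metis inj_onI)
    then have "inj_on (r \<circ> h) (carrier E)"
      using hi Uh by (intro comp_inj_on) (auto intro: inj_on_subset)
    then show ?thesis
      by (auto simp: mon_def hom_def H'c H'm hm Uh)
  qed
  have reflect: "r x = r y \<longleftrightarrow> x = y" if "x \<in> U" "y \<in> U" for x y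
    using that vr by metis
  have "satisfies H' (r \<circ> h) (r \<circ> a) c" if "c \<in> S" for c
    using a(2) S(2) that
    by (cases c) (fastforce simp: val T_def v_def[symmetric] reflect vU)+
  then have "has_solution H' (r \<circ> h) S"
    unfolding has_solution_def H'c using Ua by (intro exI[of _ "r \<circ> a"]) auto
  with E S gH' mon' show ?thesis
    unfolding existentially_closed_def by blast
qed

end

(* Approximability of G only involves finite pieces of the multiplication table of G, so it passes
   to every group that embeds locally into an approximable one. A piece of the multiplication table
   of G is a finite system of equations and inequations without coefficients; it is solvable in
   G \<times> E, hence in the existentially closed group E. Conversely a finite subset of E generates a
   countable group, which has a copy on any infinite type. *)

theory Submission
  imports Defs "HOL-Library.Countable_Set" "HOL-Algebra.Weak_Morphisms"
begin

text \<open>The condition on the identity stands in for injectivity: approximability only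
  distinguishes the identity from the other elements of \<open>\<Phi>\<close> and only sees products
  that stay in \<open>\<Phi>\<close>.\<close>

definition local_embedding ::
  "('g, 'm) monoid_scheme \<Rightarrow> ('e, 'k) monoid_scheme \<Rightarrow> 'g set \<Rightarrow> ('g \<Rightarrow> 'e) \<Rightarrow> bool" where
  "local_embedding G E \<Phi> \<psi> \<longleftrightarrow> \<psi> \<in> \<Phi> \<rightarrow> carrier E \<and>
     (\<forall>g\<in>\<Phi>. \<psi> g = \<one>\<^bsub>E\<^esub> \<longleftrightarrow> g = \<one>\<^bsub>G\<^esub>) \<and>
     (\<forall>g\<in>\<Phi>. \<forall>h\<in>\<Phi>. g \<otimes>\<^bsub>G\<^esub> h \<in> \<Phi> \<longrightarrow> \<psi> (g \<otimes>\<^bsub>G\<^esub> h) = \<psi> g \<otimes>\<^bsub>E\<^esub> \<psi> h)"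

lemma conj_products_mono: "X \<subseteq> Y \<Longrightarrow> conj_products n X H \<subseteq> conj_products n Y H"
  unfolding conj_products_def by blast

lemma separated_antimono:
  assumes "separated n Y X H" "Y' \<subseteq> Y" "X' \<subseteq> X"
  shows "separated n Y' X' H"
  using assms conj_products_mono[of X' X n H] unfolding separated_def by blast

text \<open>An approximation \<open>\<phi>\<close> of the image of \<open>\<Phi>\<close> in
  \<open>E\<close>, composed with \<open>\<psi>\<close>, approximates \<open>\<Phi>\<close>: each
  defect of the composite is a defect of \<open>\<phi>\<close>, and separation is inherited by
  smaller sets. The group \<open>E\<close> may vary with \<open>\<Phi>\<close>.\<close>

lemma approximable_of_local_embeddings:
  assumes "\<And>\<Phi>. finite \<Phi> \<Longrightarrow> \<Phi> \<subseteq> carrier G \<Longrightarrow>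
    \<exists>(E :: 'e monoid) \<psi>. approximable K E \<and> local_embedding G E \<Phi> \<psi>"
  shows "approximable K G"
  unfolding approximable_def
proof (intro allI impI)
  fix \<Phi> n
  assume \<Phi>: "finite \<Phi> \<and> \<Phi> \<subseteq> carrier G"
  obtain E :: "'e monoid" and \<psi> where E: "approximable K E" and \<psi>: "local_embedding G E \<Phi> \<psi>"
    using assms \<Phi> by blast
  then have fin: "finite (\<psi> ` \<Phi>) \<and> \<psi> ` \<Phi> \<subseteq> carrier E"
    using \<Phi> by (auto simp: local_embedding_def)
  obtain H \<phi> where H: "H \<in> K" and \<phi>: "\<phi> \<in> \<psi> ` \<Phi> \<rightarrow> carrier H"
    and one: "\<one>\<^bsub>E\<^esub> \<in> \<psi> ` \<Phi> \<longrightarrow> \<phi> \<one>\<^bsub>E\<^esub> = \<one>\<^bsub>H\<^esub>"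
    and sep: "separated n (\<phi> ` (\<psi> ` \<Phi> - {\<one>\<^bsub>E\<^esub>})) (defects E H (\<psi> ` \<Phi>) \<phi>) H"
    using E[unfolded approximable_def, rule_format, OF fin, of n] by blast
  have \<psi>1: "\<psi> g = \<one>\<^bsub>E\<^esub> \<longleftrightarrow> g = \<one>\<^bsub>G\<^esub>" if "g \<in> \<Phi>" for g
    using \<psi> that by (auto simp: local_embedding_def)
  have "defects G H \<Phi> (\<phi> \<circ> \<psi>) \<subseteq> defects E H (\<psi> ` \<Phi>) \<phi>"
  proof
    fix d assume "d \<in> defects G H \<Phi> (\<phi> \<circ> \<psi>)"
    then obtain g h where gh: "g \<in> \<Phi>" "h \<in> \<Phi>" "g \<otimes>\<^bsub>G\<^esub> h \<in> \<Phi>"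
      and d: "d = \<phi> (\<psi> g) \<otimes>\<^bsub>H\<^esub> \<phi> (\<psi> h) \<otimes>\<^bsub>H\<^esub> inv\<^bsub>H\<^esub> (\<phi> (\<psi> (g \<otimes>\<^bsub>G\<^esub> h)))"
      by (auto simp: defects_def)
    moreover have "\<psi> (g \<otimes>\<^bsub>G\<^esub> h) = \<psi> g \<otimes>\<^bsub>E\<^esub> \<psi> h"
      using \<psi> gh by (auto simp: local_embedding_def)
    ultimately show "d \<in> defects E H (\<psi> ` \<Phi>) \<phi>"
      unfolding defects_def by force
  qed
  moreover have "(\<phi> \<circ> \<psi>) ` (\<Phi> - {\<one>\<^bsub>G\<^esub>}) \<subseteq> \<phi> ` (\<psi> ` \<Phi> - {\<one>\<^bsub>E\<^esub>})"
    using \<psi>1 by auto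
  ultimately have "separated n ((\<phi> \<circ> \<psi>) ` (\<Phi> - {\<one>\<^bsub>G\<^esub>})) (defects G H \<Phi> (\<phi> \<circ> \<psi>)) H"
    using sep separated_antimono by blast
  moreover have "\<one>\<^bsub>G\<^esub> \<in> \<Phi> \<longrightarrow> (\<phi> \<circ> \<psi>) \<one>\<^bsub>G\<^esub> = \<one>\<^bsub>H\<^esub>"
    using one \<psi>1[of "\<one>\<^bsub>G\<^esub>"] by force
  moreover have "\<phi> \<circ> \<psi> \<in> \<Phi> \<rightarrow> carrier H" using \<phi> by auto
  ultimately show "\<exists>H\<in>K. \<exists>\<phi>\<in>\<Phi> \<rightarrow> carrier H. (\<one>\<^bsub>G\<^esub> \<in> \<Phi> \<longrightarrow> \<phi> \<one>\<^bsub>G\<^esub> = \<one>\<^bsub>H\<^esub>) \<and>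
      separated n (\<phi> ` (\<Phi> - {\<one>\<^bsub>G\<^esub>})) (defects G H \<Phi> \<phi>) H"
    using H by blast
qed

lemma existentially_closed_local_embedding:
  fixes E :: "'a monoid"
  assumes E: "existentially_closed E" and G: "group G"
    and \<Phi>: "finite \<Phi>" "\<Phi> \<subseteq> carrier G"
  shows "\<exists>\<psi>. local_embedding G E \<Phi> \<psi>"
proof -
  interpret G: group G by fact
  interpret E: group E using E by (simp add: existentially_closed_def)
  \<comment> \<open>\<open>\<iota>\<close> gives each element of \<open>\<Phi>\<close> a variable of
    its own.\<close>
  obtain \<iota> :: "_ \<Rightarrow> nat" where \<iota>: "inj_on \<iota> \<Phi>"
    using finite_imp_inj_to_nat_seg[OF \<Phi>(1)] by blast
  define v where "v g = (Var (\<iota> g) :: 'a gterm)" for g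
  \<comment> \<open>The first family records the products that stay in \<open>\<Phi>\<close>, the
    second which elements are trivial. No coefficient occurs, so the system makes sense over
    \<open>E\<close>.\<close>
  define S where "S =
    (\<lambda>(g, h). Equation (v (g \<otimes>\<^bsub>G\<^esub> h)) (Mult (v g) (v h))) ` {(g, h) \<in> \<Phi> \<times> \<Phi>. g \<otimes>\<^bsub>G\<^esub> h \<in> \<Phi>}
    \<union> (\<lambda>g. if g = \<one>\<^bsub>G\<^esub> then Equation (v g) One else Inequation (v g) One) ` \<Phi>"
  have "finite {(g, h) \<in> \<Phi> \<times> \<Phi>. g \<otimes>\<^bsub>G\<^esub> h \<in> \<Phi>}"
    using \<Phi>(1) by (auto intro: finite_subset[of _ "\<Phi> \<times> \<Phi>"])
  then have S: "finite S" "\<forall>c\<in>S. gconstraint_coeffs c \<subseteq> carrier E"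
    using \<Phi>(1) by (auto simp: S_def v_def)
  \<comment> \<open>The tautological solution, placed in the first factor of
    \<open>G \<times>\<times> E\<close>. Indices outside the image of \<open>\<iota>\<close> do not
    occur in \<open>S\<close>; they get the identity so that all values lie in the carrier.\<close>
  define a where "a k = (if k \<in> \<iota> ` \<Phi> then inv_into \<Phi> \<iota> k else \<one>\<^bsub>G\<^esub>, \<one>\<^bsub>E\<^esub>)" for k
  have a: "a (\<iota> g) = (g, \<one>\<^bsub>E\<^esub>)" if "g \<in> \<Phi>" for g
    using that \<iota> by (simp add: a_def)
  have "range a \<subseteq> carrier (G \<times>\<times> E)"
    using \<Phi>(2) inv_into_into[of _ \<iota> \<Phi>] by (force simp: a_def)
  moreover have "\<forall>c\<in>S. satisfies (G \<times>\<times> E) (Pair \<one>\<^bsub>G\<^esub>) a c"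
    by (auto simp: S_def v_def a split: if_splits)
  ultimately have "has_solution (G \<times>\<times> E) (Pair \<one>\<^bsub>G\<^esub>) S"
    unfolding has_solution_def by blast
  moreover have "Pair \<one>\<^bsub>G\<^esub> \<in> mon E (G \<times>\<times> E)"
    by (auto simp: mon_def hom_def inj_on_def)
  \<comment> \<open>\<open>E\<close> sits in the product as the second factor. The product lives on
    another type than \<open>'a gterm\<close>, which
    \<open>existentially_closed_has_solution\<close> allows.\<close>
  ultimately have "has_solution E id S"
    using existentially_closed_has_solution[OF E S] DirProd_group[OF G E.group_axioms] by blast
  then obtain b where b: "range b \<subseteq> carrier E" "\<forall>c\<in>S. satisfies E id b c"
    unfolding has_solution_def by blast
  \<comment> \<open>Reading the values of the variables back along \<open>\<iota>\<close> gives the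
    embedding: the equations make it multiplicative, the inequations keep nontrivial elements
    nontrivial.\<close>
  have "local_embedding G E \<Phi> (b \<circ> \<iota>)"
    unfolding local_embedding_def
  proof (intro conjI ballI impI)
    show "b \<circ> \<iota> \<in> \<Phi> \<rightarrow> carrier E" using b(1) by auto
  next
    fix g assume g: "g \<in> \<Phi>"
    then have "(if g = \<one>\<^bsub>G\<^esub> then Equation (v g) One else Inequation (v g) One) \<in> S"
      unfolding S_def by blast
    from b(2)[rule_format, OF this] show "(b \<circ> \<iota>) g = \<one>\<^bsub>E\<^esub> \<longleftrightarrow> g = \<one>\<^bsub>G\<^esub>"
      by (auto simp: v_def split: if_splits)
  next
    fix g h assume "g \<in> \<Phi>" "h \<in> \<Phi>" "g \<otimes>\<^bsub>G\<^esub> h \<in> \<Phi>"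
    then have "Equation (v (g \<otimes>\<^bsub>G\<^esub> h)) (Mult (v g) (v h)) \<in> S"
      unfolding S_def by force
    from b(2)[rule_format, OF this] show "(b \<circ> \<iota>) (g \<otimes>\<^bsub>G\<^esub> h) = (b \<circ> \<iota>) g \<otimes>\<^bsub>E\<^esub> (b \<circ> \<iota>) h"
      by (simp add: v_def)
  qed
  then show ?thesis by blast
qed

text \<open>Every element is the product of a finite word in the elements of \<open>A\<close> and
  their inverses, and there are only countably many such words.\<close>

lemma (in group) countable_generate:
  assumes "countable A" "A \<subseteq> carrier G"
  shows "countable (generate G A)"
proof -
  define p where "p xs = foldr (\<otimes>) xs \<one>" for xs
  define L where "L = lists (A \<union> m_inv G ` A)"
  have closed: "x \<in> carrier G" if "x \<in> A \<union> m_inv G ` A" for x using that assms(2) by auto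
  have p_closed: "p xs \<in> carrier G" if "xs \<in> L" for xs
    using that unfolding L_def p_def by (induction xs) (use closed in auto)
  \<comment> \<open>Concatenating words multiplies their values; this settles the case
    \<open>eng\<close> of the induction below.\<close>
  have p_append: "p (xs @ ys) = p xs \<otimes> p ys" if "xs \<in> L" "ys \<in> L" for xs ys
    using that(1)
  proof (induction xs)
    case Nil
    then show ?case using p_closed[OF that(2)] by (simp add: p_def)
  next
    case (Cons x xs)
    then have "x \<in> carrier G" "xs \<in> L" using closed by (auto simp: L_def)
    then show ?case using Cons.IH p_closed[OF that(2)] p_closed[of xs] by (simp add: p_def m_assoc)
  qed
  have "g \<in> p ` L" if "g \<in> generate G A" for g
    using that
  proof induction
    case one
    show ?case by (rule image_eqI[of _ _ "[]"]) (auto simp: p_def L_def)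
  next
    case (incl h)
    then show ?case using assms(2)
      by (intro image_eqI[of _ _ "[h]"]) (auto simp: p_def L_def)
  next
    case (inv h)
    then show ?case using assms(2)
      by (intro image_eqI[of _ _ "[m_inv G h]"]) (auto simp: p_def L_def)
  next
    case (eng g h)
    then obtain xs ys where xy: "xs \<in> L" "ys \<in> L" "g = p xs" "h = p ys" by auto
    then have "xs @ ys \<in> L" by (auto simp: L_def)
    then show ?case using p_append xy by (metis image_eqI)
  qed
  moreover have "countable (p ` L)" using assms(1) by (simp add: L_def)
  ultimately show ?thesis by (meson countable_subset subsetI)
qed

text \<open>Transport of structure along an injection, so that a group can be moved to another
  type.\<close>

lemma (in group) inj_image_group:
  assumes "inj_on f (carrier G)"
  shows "group (image_group f G)" "f \<in> mon G (image_group f G)"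
proof -
  \<comment> \<open>For injective \<open>f\<close>, two values agree exactly when the quotient of
    the arguments is trivial, so \<open>f\<close> is a weak morphism modulo the trivial
    subgroup.\<close>
  have "weak_group_morphism f {\<one>} G"
    using assms one_is_normal
    by (intro weak_group_morphismsI) (auto simp: inj_on_eq_iff inv_equality inv_solve_right')
  then show "group (image_group f G)" "f \<in> mon G (image_group f G)"
    using image_group_is_group weak_group_morphism_is_hom assms by (auto simp: mon_def)
qed

text \<open>The whole of \<open>G\<close> may be too large for \<open>'c\<close>, but the subgroup
  generated by \<open>\<Phi>\<close> is countable and so fits into any infinite type.\<close>

lemma (in group) ex_local_embedding_infinite_type:
  assumes "infinite (UNIV :: 'c set)" "finite \<Phi>" "\<Phi> \<subseteq> carrier G"
  shows "\<exists>(G' :: 'c monoid) \<psi>. group G' \<and> local_embedding G G' \<Phi> \<psi>"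
proof -
  define U where "U = G\<lparr>carrier := generate G \<Phi>\<rparr>"
  have sub: "subgroup (generate G \<Phi>) G" using assms(3) by (rule generate_is_subgroup)
  interpret U: group U unfolding U_def using sub by (rule subgroup_imp_group)
  have count: "countable (carrier U)"
    using countable_generate assms(2,3) by (simp add: U_def countable_finite)
  \<comment> \<open>An infinite type contains a copy of the natural numbers; an enumeration of
    \<open>U\<close> followed by \<open>e\<close> moves \<open>U\<close> into
    \<open>'c\<close>.\<close>
  obtain e :: "nat \<Rightarrow> 'c" where e: "inj e" using assms(1) infinite_countable_subset by blast
  define f where "f = e \<circ> to_nat_on (carrier U)"
  have inj: "inj_on f (carrier U)"
    unfolding f_def using count e by (intro comp_inj_on) (auto intro: inj_on_subset)
  interpret U': group "image_group f U" using U.inj_image_group(1)[OF inj] .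
  have f: "f \<in> hom U (image_group f U)" using U.inj_image_group(2)[OF inj] by (simp add: mon_def)
  have \<Phi>U: "\<Phi> \<subseteq> carrier U" by (auto simp: U_def generate.incl)
  have one: "f \<one> = \<one>\<^bsub>image_group f U\<^esub>" by (simp add: image_group_one U_def)
  have "local_embedding G (image_group f U) \<Phi> f"
    unfolding local_embedding_def
  proof (intro conjI ballI impI)
    show "f \<in> \<Phi> \<rightarrow> carrier (image_group f U)" using \<Phi>U by (auto simp: image_group_carrier)
  next
    fix g assume "g \<in> \<Phi>"
    moreover have "\<one> \<in> carrier U" using U.one_closed by (simp add: U_def)
    ultimately show "f g = \<one>\<^bsub>image_group f U\<^esub> \<longleftrightarrow> g = \<one>"
      unfolding one[symmetric] using inj \<Phi>U by (auto simp: inj_on_eq_iff)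
  next
    fix g h assume "g \<in> \<Phi>" "h \<in> \<Phi>"
    then have "g \<in> carrier U" "h \<in> carrier U" using \<Phi>U by auto
    from hom_mult[OF f this] show "f (g \<otimes> h) = f g \<otimes>\<^bsub>image_group f U\<^esub> f h" by (simp add: U_def)
  qed
  then show ?thesis using U'.group_axioms by blast
qed

text \<open>A statement cannot quantify over types, so all groups means all groups on
  \<open>'b\<close>, an arbitrary infinite type. Infinitude makes room there for copies of countable
  groups, which the implication towards \<open>E\<close> uses.\<close>

theorem mainTheorem6:
  fixes K :: "nat monoid set" and E :: "'a monoid"
  assumes "K \<in> {Nil_groups, Sol_groups, Alt_groups, Sym_groups, Fin_groups}"
    and "existentially_closed E"
    and "infinite (UNIV :: 'b set)"
  shows "approximable K E \<longleftrightarrow> (\<forall>G :: 'b monoid. group G \<longrightarrow> approximable K G)"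
proof (intro iffI allI impI)
  fix G :: "'b monoid"
  assume "approximable K E" "group G"
  \<comment> \<open>Here every \<open>\<Phi>\<close> embeds into the same group
    \<open>E\<close>.\<close>
  then show "approximable K G"
    using existentially_closed_local_embedding[OF assms(2)]
    by (metis approximable_of_local_embeddings)
next
  assume K: "\<forall>G :: 'b monoid. group G \<longrightarrow> approximable K G"
  interpret E: group E using assms(2) by (simp add: existentially_closed_def)
  show "approximable K E"
  \<comment> \<open>Here the group on \<open>'b\<close> depends on \<open>\<Phi>\<close>: it is a
    copy of the subgroup of \<open>E\<close> that \<open>\<Phi>\<close> generates.\<close>
  proof (rule approximable_of_local_embeddings)
    fix \<Phi> assume "finite \<Phi>" "\<Phi> \<subseteq> carrier E"
    from E.ex_local_embedding_infinite_type[OF assms(3) this] K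
    show "\<exists>(G :: 'b monoid) \<psi>. approximable K G \<and> local_embedding E G \<Phi> \<psi>" by metis
  qed
qed

end
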